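(* Let $k\geq 3$ and let $P:\{0,1\}^k\to\{0,1\}$ be a symmetric predicate other than $k$-EQU. Then for any $\epsilon>0$, there exists $d\geq 1$ such that any one-sided error $(|P^{-1}(0)|/2^k-\epsilon)$-tester for CSP($P$) with degree bound $d$ requires $\Omega(n)$ queries, where $n$ is the number of variables.
   Context: All predicates satisfy $|P^{-1}(1)|>0$. A predicate $P:\{0,1\}^k\to\{0,1\}$ is symmetric if (i) $P(x)=P(y)$ whenever $x,y$ have the same Hamming weight and (ii) $P(x)=P(\overline{x})$ for all $x$, where $\overline{x}=(1,\dots,1)-x$. $k$-EQU is the predicate satisfied iff all $k$ inputs are equal. An instance of CSP($P$) consists of Boolean variables and constraints, each on a $k$-tuple of variables $(x_1,\dots,x_k)$ and of the form $P(x_1+b_1,\dots,x_k+b_k)=1$ for some $b\in\{0,1\}^k$ (addition mod 2). Bounded-degree model with degree bound $d$: each variable appears in at most $d$ constraints; an algorithm accesses the instance only via an oracle that, given a variable $x$ and an index $1\le i\le d$, returns the $i$-th constraint containing $x$ (or a special symbol if none exists); query complexity is the number of oracle calls. An instance is $\epsilon$-far from satisfiability if at least $\epsilon dn/k$ constraints must be removed to make it satisfiable. An $\epsilon$-tester is a randomized algorithm that accepts every satisfiable instance with probability at least $2/3$ and rejects every instance $\epsilon$-far from satisfiability with probability at least $2/3$; it is one-sided error if it accepts every satisfiable instance with probability $1$. *)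

theory Defs
  imports "HOL-Probability.Probability"
begin

text \<open>
  The cube \<open>{0,1}\<^sup>k\<close> is the set of Boolean lists of length \<open>k\<close>. A predicate on it is a
  function \<open>P :: bool list \<Rightarrow> bool\<close> whose values on lists of other lengths never matter.
\<close>

definition cube :: "nat \<Rightarrow> bool list set" where
  "cube k = {x. length x = k}"

definition hamming_weight :: "bool list \<Rightarrow> nat" where
  "hamming_weight x = count_list x True"

definition symmetric_pred :: "nat \<Rightarrow> (bool list \<Rightarrow> bool) \<Rightarrow> bool" where
  "symmetric_pred k P \<longleftrightarrow>
     (\<forall>x\<in>cube k. \<forall>y\<in>cube k. hamming_weight x = hamming_weight y \<longrightarrow> P x = P y) \<and>
     (\<forall>x\<in>cube k. P x = P (map Not x))"

definition EQU :: "bool list \<Rightarrow> bool" where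
  "EQU x \<longleftrightarrow> (\<forall>a\<in>set x. \<forall>b\<in>set x. a = b)"


text \<open>
  The variables of an instance are \<open>0, \<dots>, n - 1\<close>. A constraint \<open>(vs, bs)\<close> stands for
  \<open>P (vs\<^sub>1 + bs\<^sub>1, \<dots>, vs\<^sub>k + bs\<^sub>k) = 1\<close>; addition modulo 2 is disequality of Booleans.
  The constraints form a list, which may contain repetitions; its order determines which
  constraint is the \<open>i\<close>-th one containing a given variable.
\<close>

type_synonym constraint = "nat list \<times> bool list"

definition sat_constraint ::
    "(bool list \<Rightarrow> bool) \<Rightarrow> (nat \<Rightarrow> bool) \<Rightarrow> constraint \<Rightarrow> bool" where
  "sat_constraint P a c = P (map2 (\<lambda>v b. a v \<noteq> b) (fst c) (snd c))"

definition satisfiable :: "(bool list \<Rightarrow> bool) \<Rightarrow> constraint list \<Rightarrow> bool" where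
  "satisfiable P cs \<longleftrightarrow> (\<exists>a. \<forall>c\<in>set cs. sat_constraint P a c)"

definition constraints_on :: "constraint list \<Rightarrow> nat \<Rightarrow> constraint list" where
  "constraints_on cs x = filter (\<lambda>c. x \<in> set (fst c)) cs"

definition csp_instance :: "nat \<Rightarrow> nat \<Rightarrow> nat \<Rightarrow> constraint list \<Rightarrow> bool" where
  "csp_instance k n d cs \<longleftrightarrow>
     (\<forall>(vs, bs)\<in>set cs. length vs = k \<and> length bs = k \<and> set vs \<subseteq> {..<n}) \<and>
     (\<forall>x<n. length (constraints_on cs x) \<le> d)"

text \<open>\<open>R\<close> ranges over the sets of (positions of) constraints whose removal leaves a
  satisfiable instance.\<close>

definition far_from_sat ::
    "nat \<Rightarrow> (bool list \<Rightarrow> bool) \<Rightarrow> nat \<Rightarrow> nat \<Rightarrow> real \<Rightarrow> constraint list \<Rightarrow> bool" where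
  "far_from_sat k P n d \<delta> cs \<longleftrightarrow>
     (\<forall>R\<subseteq>{..<length cs}. satisfiable P (nths cs (- R)) \<longrightarrow>
        real (card R) \<ge> \<delta> * real d * real n / real k)"


text \<open>Indices start at 1; \<open>None\<close> is the special symbol for a nonexistent constraint.\<close>

definition query_answer :: "constraint list \<Rightarrow> nat \<Rightarrow> nat \<Rightarrow> constraint option" where
  "query_answer cs x i =
     (if 1 \<le> i \<and> i \<le> length (constraints_on cs x)
      then Some (constraints_on cs x ! (i - 1)) else None)"

text \<open>
  Deterministic adaptive query algorithms are decision trees over query results (\<open>Answer True\<close>
  accepts). A randomized algorithm is a probability distribution over them: the random
  outcome selects a deterministic algorithm. Algorithms may depend arbitrarily on \<open>n\<close>.
\<close>

datatype query_alg =
    Answer bool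
  | Query nat nat "constraint option \<Rightarrow> query_alg"

primrec accepts :: "(nat \<Rightarrow> nat \<Rightarrow> constraint option) \<Rightarrow> query_alg \<Rightarrow> bool" where
  "accepts orc (Answer b) = b"
| "accepts orc (Query x i f) = accepts orc (f (orc x i))"

primrec num_queries :: "(nat \<Rightarrow> nat \<Rightarrow> constraint option) \<Rightarrow> query_alg \<Rightarrow> nat" where
  "num_queries orc (Answer b) = 0"
| "num_queries orc (Query x i f) = Suc (num_queries orc (f (orc x i)))"

definition accept_prob :: "query_alg pmf \<Rightarrow> constraint list \<Rightarrow> real" where
  "accept_prob T cs = measure_pmf.prob T {t. accepts (query_answer cs) t}"

definition reject_prob :: "query_alg pmf \<Rightarrow> constraint list \<Rightarrow> real" where
  "reject_prob T cs = measure_pmf.prob T {t. \<not> accepts (query_answer cs) t}"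

definition tester ::
    "nat \<Rightarrow> (bool list \<Rightarrow> bool) \<Rightarrow> nat \<Rightarrow> nat \<Rightarrow> real \<Rightarrow> query_alg pmf \<Rightarrow> bool" where
  "tester k P n d \<delta> T \<longleftrightarrow>
     (\<forall>cs. csp_instance k n d cs \<longrightarrow>
        (satisfiable P cs \<longrightarrow> accept_prob T cs \<ge> 2 / 3) \<and>
        (far_from_sat k P n d \<delta> cs \<longrightarrow> reject_prob T cs \<ge> 2 / 3))"

definition one_sided_tester ::
    "nat \<Rightarrow> (bool list \<Rightarrow> bool) \<Rightarrow> nat \<Rightarrow> nat \<Rightarrow> real \<Rightarrow> query_alg pmf \<Rightarrow> bool" where
  "one_sided_tester k P n d \<delta> T \<longleftrightarrow>
     tester k P n d \<delta> T \<and>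
     (\<forall>cs. csp_instance k n d cs \<longrightarrow> satisfiable P cs \<longrightarrow> accept_prob T cs = 1)"

text \<open>Worst case over all instances of the model and all random outcomes.\<close>

definition query_complexity_le :: "nat \<Rightarrow> nat \<Rightarrow> nat \<Rightarrow> query_alg pmf \<Rightarrow> nat \<Rightarrow> bool" where
  "query_complexity_le k n d T q \<longleftrightarrow>
     (\<forall>cs t. csp_instance k n d cs \<longrightarrow> t \<in> set_pmf T \<longrightarrow> num_queries (query_answer cs) t \<le> q)"

end

theory Submission
  imports Defs "HOL-Combinatorics.Permutations"
begin

text \<open>
  The hard instances have \<open>m = D n\<close> constraints and \<open>d = k D\<close>. Their variables come from the
  configuration model: a random permutation \<open>\<tau>\<close> of the \<open>k D n\<close> slots puts the variable
  \<open>\<tau> z mod n\<close> into slot \<open>z\<close>, which makes every variable fill exactly \<open>k D\<close> slots. By a union bound,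
  some \<open>\<tau>\<close> makes every set of \<open>s \<le> c n\<close> constraints contain more than \<open>(k - 3/2) s\<close> variables. Such
  a set has a constraint with \<open>k - 2\<close> variables that occur nowhere else in the set; as \<open>P\<close> is
  symmetric and differs from \<open>k\<close>-EQU, any values of the other two inputs extend to a satisfying
  one, and peeling off constraints shows that the set is satisfiable whatever the signs are.
  Independent random signs make every one of the \<open>2\<^sup>n\<close> assignments violate almost a
  \<open>|P\<^sup>-\<^sup>1(0)| / 2\<^sup>k\<close> fraction of the constraints once \<open>D\<close> is large. A one-sided tester that saw at
  most \<open>c n\<close> constraints cannot reject, since what it saw is consistent with a satisfiable instance.
\<close>

section \<open>Expansion of random hypergraphs\<close>

text \<open>Double count the pairs of a permutation \<open>\<sigma>\<close> sending \<open>J\<close>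
  into \<open>W\<close> and a point \<open>y\<close> of \<open>A - J\<close> with
  \<open>\<sigma> y \<in> W\<close>: each \<open>\<sigma>\<close> has \<open>card W - card J\<close>
  such points, and by symmetry each point has equally many \<open>\<sigma>\<close>. If
  \<open>card W < card J\<close>, no such \<open>\<sigma>\<close> exists and both sides are
  0.\<close>

lemma permutes_into_Suc_count:
  assumes "finite A" "J \<subseteq> A" "W \<subseteq> A" "x \<in> A - J"
  shows "(card A - card J) * card {\<sigma>. \<sigma> permutes A \<and> \<sigma> ` insert x J \<subseteq> W} =
         (card W - card J) * card {\<sigma>. \<sigma> permutes A \<and> \<sigma> ` J \<subseteq> W}"
proof -
  let ?N = "{\<sigma>. \<sigma> permutes A \<and> \<sigma> ` J \<subseteq> W}"
  let ?M = "\<lambda>y. {\<sigma>\<in>?N. \<sigma> y \<in> W}"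
  have fin: "finite ?N"
    using finite_permutations[OF assms(1)] by (rule rev_finite_subset) auto
  have finJ: "finite J" "finite W"
    using assms finite_subset by auto
  \<comment> \<open>Precomposition with the transposition of \<open>y\<close> and \<open>z\<close>
    keeps the values on \<open>J\<close> and moves the value at \<open>y\<close> to
    \<open>z\<close>.\<close>
  have maps: "(\<lambda>\<sigma>. \<sigma> \<circ> Transposition.transpose y z) ` ?M y \<subseteq> ?M z"
    if "y \<in> A - J" "z \<in> A - J" for y z
  proof -
    have t: "Transposition.transpose y z permutes A"
      using that by (intro permutes_swap_id) auto
    have "Transposition.transpose y z j = j" if "j \<in> J" for j
      using that \<open>y \<in> A - J\<close> \<open>z \<in> A - J\<close> by (intro transpose_apply_other) auto
    then show ?thesis
      using t by (auto intro: permutes_compose)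
  qed
  have le: "card (?M y) \<le> card (?M z)" if "y \<in> A - J" "z \<in> A - J" for y z
  proof (rule card_inj_on_le[OF _ maps[OF that]])
    show "inj_on (\<lambda>\<sigma>. \<sigma> \<circ> Transposition.transpose y z) (?M y)"
    proof (rule inj_onI)
      fix \<sigma> \<tau> assume "\<sigma> \<circ> Transposition.transpose y z = \<tau> \<circ> Transposition.transpose y z"
      then have "\<sigma> \<circ> (Transposition.transpose y z \<circ> Transposition.transpose y z) =
          \<tau> \<circ> (Transposition.transpose y z \<circ> Transposition.transpose y z)"
        by (simp only: o_assoc)
      then show "\<sigma> = \<tau>" by (simp only: transpose_comp_involutory comp_id)
    qed
    show "finite (?M z)" using fin by (rule rev_finite_subset) blast
  qed
  have eq: "card (?M y) = card (?M x)" if "y \<in> A - J" for y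
    using le[OF that assms(4)] le[OF assms(4) that] by simp
  have cnt: "card {y\<in>A - J. \<sigma> y \<in> W} = card W - card J" if "\<sigma> \<in> ?N" for \<sigma>
  proof -
    have s: "\<sigma> permutes A" "\<sigma> ` J \<subseteq> W" using that by auto
    have inj: "inj \<sigma>" using s(1) by (rule permutes_inj)
    have "W \<subseteq> \<sigma> ` A" using permutes_image[OF s(1)] assms(3) by simp
    then have "\<sigma> ` {y\<in>A - J. \<sigma> y \<in> W} = W - \<sigma> ` J"
      using inj by (auto dest: injD)
    then have "card {y\<in>A - J. \<sigma> y \<in> W} = card (W - \<sigma> ` J)"
      using card_image[OF inj_on_subset[OF inj subset_UNIV]] by metis
    also have "\<dots> = card W - card J"
      using s(2) finJ card_image[OF inj_on_subset[OF inj subset_UNIV]]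
      by (subst card_Diff_subset) auto
    finally show ?thesis .
  qed
  have "(card A - card J) * card (?M x) = (\<Sum>y\<in>A - J. card (?M y))"
    using eq assms(2) finJ by (simp add: card_Diff_subset)
  also have "\<dots> = (\<Sum>y\<in>A - J. \<Sum>\<sigma>\<in>?N. if \<sigma> y \<in> W then 1 else 0)"
    using fin by (simp add: sum.If_cases Int_def)
  also have "\<dots> = (\<Sum>\<sigma>\<in>?N. \<Sum>y\<in>A - J. if \<sigma> y \<in> W then 1 else 0)"
    by (rule sum.swap)
  also have "\<dots> = (\<Sum>\<sigma>\<in>?N. card W - card J)"
    using cnt assms(1) by (intro sum.cong refl) (simp add: sum.If_cases Int_def)
  also have "\<dots> = (card W - card J) * card ?N"
    by simp
  also have "?M x = {\<sigma>. \<sigma> permutes A \<and> \<sigma> ` insert x J \<subseteq> W}"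
    by auto
  finally show ?thesis .
qed

text \<open>Expose the images of a random permutation point by point: given that \<open>J\<close>
  went into \<open>W\<close>, the next point does so with probability
  \<open>(card W - card J) / (card A - card J)\<close>, which is at most
  \<open>card W / card A\<close>. The bound on probabilities is stated with denominators multiplied
  out.\<close>

lemma card_permutes_into_le:
  assumes "finite A" "J \<subseteq> A" "W \<subseteq> A"
  shows "card {\<sigma>. \<sigma> permutes A \<and> \<sigma> ` J \<subseteq> W} * card A ^ card J \<le> fact (card A) * card W ^ card J"
  using finite_subset[OF assms(2,1)] assms(2)
proof (induction J rule: finite_induct)
  case empty
  then show ?case using assms(1) by (simp add: card_permutations[OF refl])
next
  case (insert x J)
  let ?N = "card {\<sigma>. \<sigma> permutes A \<and> \<sigma> ` J \<subseteq> W}"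
  let ?N' = "card {\<sigma>. \<sigma> permutes A \<and> \<sigma> ` insert x J \<subseteq> W}"
  have lt: "card J < card A"
    using insert assms(1) by (intro psubset_card_mono) auto
  have wA: "card W \<le> card A" using assms by (simp add: card_mono)
  have "card A * (card W - card J) \<le> card W * (card A - card J)"
    using wA by (simp add: diff_mult_distrib2 mult.commute diff_le_mono2)
  then have "card A * (card W - card J) * ?N \<le> card W * (card A - card J) * ?N"
    by (rule mult_le_mono1)
  moreover have "(card A - card J) * ?N' = (card W - card J) * ?N"
    using insert assms by (intro permutes_into_Suc_count) auto
  moreover have "(card A - card J) * (card A * ?N') = card A * ((card A - card J) * ?N')"
    by (simp only: mult_ac)
  ultimately have "(card A - card J) * (card A * ?N') \<le> (card A - card J) * (card W * ?N)"
    by (simp only: mult_ac)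
  then have step: "card A * ?N' \<le> card W * ?N"
    using lt by simp
  have "?N' * card A ^ card (insert x J) = card A * ?N' * card A ^ card J"
    using insert by simp
  also have "\<dots> \<le> card W * ?N * card A ^ card J"
    using step by (rule mult_le_mono1)
  also have "\<dots> = card W * (?N * card A ^ card J)" by simp
  also have "\<dots> \<le> card W * (fact (card A) * card W ^ card J)"
    using insert by (intro mult_le_mono2) auto
  also have "\<dots> = fact (card A) * card W ^ card (insert x J)"
    using insert by simp
  finally show ?case .
qed

lemma card_mod_preimage:
  assumes "V \<subseteq> {..<n}"
  shows "card {z. z < M * n \<and> z mod n \<in> V} = M * card V"
proof -
  have "bij_betw (\<lambda>(q, r). q * n + r) ({..<M} \<times> V) {z. z < M * n \<and> z mod n \<in> V}"
  proof (rule bij_betwI[where g = "\<lambda>z. (z div n, z mod n)"])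
    show "(\<lambda>(q, r). q * n + r) \<in> {..<M} \<times> V \<rightarrow> {z. z < M * n \<and> z mod n \<in> V}"
    proof (safe)
      fix q r assume "q < M" "r \<in> V"
      then have r: "r < n" using assms by auto
      have "q * n + r < Suc q * n" using r by simp
      also have "\<dots> \<le> M * n" using \<open>q < M\<close> by (intro mult_le_mono1) simp
      finally show "q * n + r < M * n" .
      show "(q * n + r) mod n \<in> V" using r \<open>r \<in> V\<close> by simp
    qed
    show "(\<lambda>z. (z div n, z mod n)) \<in> {z. z < M * n \<and> z mod n \<in> V} \<rightarrow> {..<M} \<times> V"
      by (auto simp: less_mult_imp_div_less)
  qed (use assms in auto)
  then have "card ({..<M} \<times> V) = card {z. z < M * n \<and> z mod n \<in> V}"
    by (rule bij_betw_same_card)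
  then show ?thesis by (simp add: card_cartesian_product)
qed

lemma card_div_preimage:
  assumes "E \<subseteq> {..<m}"
  shows "card {z. z < m * k \<and> z div k \<in> E} = card E * (k::nat)"
proof (cases "k = 0")
  case False
  have "bij_betw (\<lambda>(p, i). p * k + i) (E \<times> {..<k}) {z. z < m * k \<and> z div k \<in> E}"
  proof (rule bij_betwI[where g = "\<lambda>z. (z div k, z mod k)"])
    show "(\<lambda>(p, i). p * k + i) \<in> E \<times> {..<k} \<rightarrow> {z. z < m * k \<and> z div k \<in> E}"
    proof (safe)
      fix p i assume "p \<in> E" "i < k"
      then have p: "p < m" using assms by auto
      have "p * k + i < Suc p * k" using \<open>i < k\<close> by simp
      also have "\<dots> \<le> m * k" using p by (intro mult_le_mono1) simp
      finally show "p * k + i < m * k" .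
      show "(p * k + i) div k \<in> E" using \<open>i < k\<close> \<open>p \<in> E\<close> by simp
    qed
    show "(\<lambda>z. (z div k, z mod k)) \<in> {z. z < m * k \<and> z div k \<in> E} \<rightarrow> E \<times> {..<k}"
      using False by auto
  qed auto
  then have "card (E \<times> {..<k}) = card {z. z < m * k \<and> z div k \<in> E}"
    by (rule bij_betw_same_card)
  then show ?thesis by (simp add: card_cartesian_product)
qed simp

section \<open>Union bound estimates for the configuration model\<close>

lemma power_self_le_exp_fact: "real s ^ s \<le> exp (real s) * fact s"
proof -
  have "real s ^ s /\<^sub>R fact s \<le> exp (real s)"
    using summable_exp_generic[of "real s"] sum_le_suminf[of "\<lambda>n. real s ^ n /\<^sub>R fact n" "{s}"]
    by (simp add: exp_def)
  then show ?thesis by (simp add: field_simps)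
qed

text \<open>This is the usual bound of the binomial coefficient by (eN/s)^s; the product form also
  covers \<open>s = 0\<close>.\<close>

lemma binomial_mult_power_le: "real (N choose s) * real s ^ s \<le> exp (real s) * real N ^ s"
proof -
  have "fact s * (N choose s) \<le> N ^ s"
  proof (cases "s \<le> N")
    case True
    have "fact s * (N choose s) * fact (N - s) = (fact N :: nat)"
      using binomial_fact_lemma[OF True] by (simp add: mult_ac)
    also have "\<dots> \<le> N ^ s * fact (N - s)"
      using fact_div_fact_le_pow[OF True] True
      by (metis dvd_div_mult_self diff_le_self fact_dvd mult_le_mono1)
    finally show ?thesis by simp
  qed (simp add: binomial_eq_0)
  then have b: "fact s * real (N choose s) \<le> real N ^ s"
    by (metis of_nat_fact of_nat_le_iff of_nat_mult of_nat_power)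
  have "real (N choose s) * real s ^ s \<le> real (N choose s) * (exp (real s) * fact s)"
    by (intro mult_left_mono power_self_le_exp_fact) simp
  also have "\<dots> = exp (real s) * (fact s * real (N choose s))" by simp
  also have "\<dots> \<le> exp (real s) * real N ^ s"
    using b by (intro mult_left_mono) auto
  finally show ?thesis .
qed

text \<open>Constraint \<open>p\<close> owns the block of slots from \<open>p * k\<close> to
  \<open>p * k + k - 1\<close>. The result is a list because a variable may fill several slots of
  one constraint.\<close>

definition slot_edge :: "nat \<Rightarrow> nat \<Rightarrow> (nat \<Rightarrow> nat) \<Rightarrow> nat \<Rightarrow> nat list" where
  "slot_edge k n \<tau> p = map (\<lambda>i. \<tau> (p * k + i) mod n) [0..<k]"

text \<open>The event says that the \<open>k * card E\<close> slots of \<open>E\<close> are sent to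
  values whose residues lie in \<open>V\<close>. These values form a fraction
  \<open>card V / n\<close> of all values.\<close>

lemma card_bad_permutations_le:
  fixes k n D :: nat
  assumes "E \<subseteq> {..<D * n}" "V \<subseteq> {..<n}" "0 < k" "0 < n" "0 < D"
  shows "real (card {\<tau>. \<tau> permutes {..<D * n * k} \<and> (\<Union>p\<in>E. set (slot_edge k n \<tau> p)) \<subseteq> V})
    \<le> fact (D * n * k) * (real (card V) / real n) ^ (k * card E)"
    (is "real (card ?B) \<le> _")
proof -
  define N where "N = D * n * k"
  define J where "J = {z. z < D * n * k \<and> z div k \<in> E}"
  define W where "W = {z. z < (D * k) * n \<and> z mod n \<in> V}"
  have JN: "J \<subseteq> {..<N}" and WN: "W \<subseteq> {..<N}" by (auto simp: J_def W_def N_def algebra_simps)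
  have cJ: "card J = k * card E" using card_div_preimage[OF assms(1), of k] by (simp add: J_def)
  have cW: "card W = D * k * card V" using card_mod_preimage[OF assms(2)] by (simp add: W_def)
  have "?B \<subseteq> {\<tau>. \<tau> permutes {..<N} \<and> \<tau> ` J \<subseteq> W}"
  proof safe
    fix \<tau> z assume \<tau>: "\<tau> permutes {..<D * n * k}" "(\<Union>p\<in>E. set (slot_edge k n \<tau> p)) \<subseteq> V"
    then show "\<tau> permutes {..<N}" by (simp add: N_def)
    assume z: "z \<in> J"
    have "\<tau> (z div k * k + z mod k) mod n \<in> set (slot_edge k n \<tau> (z div k))"
      unfolding slot_edge_def set_map using assms(3) by (intro imageI) simp
    then have "\<tau> z mod n \<in> V" using \<tau>(2) z by (auto simp: J_def)
    moreover have "\<tau> z < N" using permutes_in_image[OF \<tau>(1), of z] z by (simp add: J_def N_def)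
    ultimately show "\<tau> z \<in> W" by (simp add: W_def N_def mult_ac)
  qed
  then have "card ?B \<le> card {\<tau>. \<tau> permutes {..<N} \<and> \<tau> ` J \<subseteq> W}"
    by (intro card_mono finite_subset[OF _ finite_permutations[of "{..<N}"]]) auto
  then have "card ?B * N ^ card J \<le> card {\<tau>. \<tau> permutes {..<N} \<and> \<tau> ` J \<subseteq> W} * N ^ card J"
    by (rule mult_le_mono1)
  also have "\<dots> \<le> fact N * card W ^ card J"
    using card_permutes_into_le[OF finite_lessThan JN WN] by simp
  finally have "real (card ?B * N ^ card J) \<le> real (fact N * card W ^ card J)"
    by (simp only: of_nat_le_iff)
  then have le: "real (card ?B) * real N ^ card J \<le> fact N * real (card W) ^ card J"
    by simp
  have N0: "real N > 0" using assms by (simp add: N_def)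
  have "real (card ?B) \<le> fact N * (real (card W) / real N) ^ card J"
    using le N0 by (simp add: power_divide field_simps)
  also have "real (card W) / real N = real (card V) / real n"
    using assms by (simp add: cW N_def)
  finally show ?thesis by (simp add: cJ N_def)
qed

text \<open>Put y = sqrt(ks/n). Choosing the edges costs about y^(-2s), while choosing the vertices
  is paid for, up to exp(ks), by v of the ks factors v/n. The remaining ks - v factors give
  y^(2(ks-v)), at most y^(3s) because v is at most (k - 3/2)s. A factor y^s survives, which is what
  makes small sets unlikely to be bad.\<close>

lemma union_bound_term_le:
  fixes k n D s v :: nat
  assumes "2 \<le> k" "0 < n" "0 < s" "k * s \<le> n" "2 * v \<le> (2 * k - 3) * s"
  shows "real (D * n choose s) * real (n choose v) * (real v / real n) ^ (k * s)
    \<le> (exp (real (k + 1)) * real D * real k * sqrt (real (k * s) / real n)) ^ s"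
proof -
  define y where "y = sqrt (real (k * s) / real n)"
  have y: "0 < y" "y \<le> 1" "y\<^sup>2 = real (k * s) / real n"
    using assms by (auto simp: y_def simp flip: of_nat_mult)
  have vks: "2 * v + 3 * s \<le> 2 * (k * s)"
  proof -
    have "(2 * k - 3) * s + 3 * s = 2 * (k * s)"
      using assms(1) by (simp flip: add_mult_distrib)
    then show ?thesis using assms(5) by linarith
  qed
  have y0: "y \<noteq> 0" using y(1) by simp
  have vk: "v \<le> k * s" using vks by linarith
  have "real (D * n choose s) * real s ^ s \<le> exp (real s) * real (D * n) ^ s"
    by (rule binomial_mult_power_le)
  then have "real (D * n choose s) \<le> exp (real s) * real (D * n) ^ s / real s ^ s"
    using assms(3) by (simp add: field_simps)
  also have "\<dots> = (exp 1 * (real D * real n / real s)) ^ s"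
    by (simp add: power_mult_distrib power_divide exp_of_nat_mult[of s 1, simplified])
  also have "real D * real n / real s = real D * real k / y\<^sup>2"
    using assms by (simp add: y(3) field_simps)
  finally have 1: "real (D * n choose s) \<le> (exp 1 * (real D * real k / y\<^sup>2)) ^ s" .
  have "real (n choose v) * (real v / real n) ^ v \<le> exp (real v)"
    using binomial_mult_power_le[of n v] assms(2) by (simp add: power_divide field_simps)
  also have "\<dots> \<le> exp (real k * real s)"
    using vk by (simp flip: of_nat_mult)
  finally have 2: "real (n choose v) * (real v / real n) ^ v \<le> exp (real k * real s)" .
  have "(real v / real n) ^ (k * s - v) \<le> (y\<^sup>2) ^ (k * s - v)"
    unfolding y(3) using vk by (intro power_mono divide_right_mono) (auto simp flip: of_nat_mult)
  also have "\<dots> = y ^ (2 * (k * s - v))" by (simp add: power_mult)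
  also have "\<dots> \<le> y ^ (3 * s)"
    using y vks by (intro power_decreasing) auto
  finally have 3: "(real v / real n) ^ (k * s - v) \<le> y ^ (3 * s)" .
  have "(real v / real n) ^ (k * s) = (real v / real n) ^ v * (real v / real n) ^ (k * s - v)"
    using vk by (simp flip: power_add)
  then have "real (D * n choose s) * real (n choose v) * (real v / real n) ^ (k * s) =
      real (D * n choose s) * ((real (n choose v) * (real v / real n) ^ v) * (real v / real n) ^ (k * s - v))"
    by simp
  also have "\<dots> \<le> (exp 1 * (real D * real k / y\<^sup>2)) ^ s * (exp (real k * real s) * y ^ (3 * s))"
    by (intro mult_mono 1 2 3) auto
  also have "\<dots> = (exp 1 * (real D * real k / y\<^sup>2) * exp (real k) * y ^ 3) ^ s"
    by (simp only: power_mult_distrib power_mult exp_of_nat2_mult mult.assoc)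
  also have "exp 1 * (real D * real k / y\<^sup>2) * exp (real k) * y ^ 3 =
      exp (real (k + 1)) * real D * real k * y"
    using y0 by (simp add: exp_add power2_eq_square power3_eq_cube)
  finally show ?thesis by (simp add: y_def)
qed

text \<open>If every permutation had a bad edge set, the bad events would cover all permutations;
  but their probabilities, summed over sets of size s, are at most 3^(-s), and these sum to less
  than 1.\<close>

lemma exists_expanding_slot_hypergraph:
  fixes k D :: nat
  assumes "k \<ge> 2" "D > 0"
  shows "\<exists>c>0. \<forall>n>0. \<exists>\<tau>. \<tau> permutes {..<D * n * k} \<and>
    (\<forall>E. E \<subseteq> {..<D * n} \<longrightarrow> E \<noteq> {} \<longrightarrow> real (card E) \<le> c * real n \<longrightarrow>
      (2 * k - 3) * card E < 2 * card (\<Union>p\<in>E. set (slot_edge k n \<tau> p)))"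
proof -
  define K where "K = exp (real (k + 1)) * real D * real k"
  \<comment> \<open>This choice gives \<open>K * sqrt (k * s / n) \<le> 1 / 3\<close> for all
    \<open>s \<le> c * n\<close>. As \<open>K \<ge> 1\<close>, it also gives
    \<open>k * s \<le> n\<close>.\<close>
  define c where "c = 1 / (9 * real k * K\<^sup>2)"
  have "1 \<le> exp (real (k + 1))" by simp
  moreover have "1 \<le> real D * real k" using assms by (simp flip: of_nat_mult)
  ultimately have "1 * 1 \<le> exp (real (k + 1)) * (real D * real k)" by (intro mult_mono) auto
  then have K: "1 \<le> K" by (simp add: K_def mult.assoc)
  then have K2: "1 \<le> K\<^sup>2" by simp
  have c: "c > 0" using K assms by (simp add: c_def)
  have kc: "real k * c = (1 / (3 * K))\<^sup>2"
    using assms K by (simp add: c_def power2_eq_square)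
  have "\<exists>\<tau>. \<tau> permutes {..<D * n * k} \<and>
    (\<forall>E. E \<subseteq> {..<D * n} \<longrightarrow> E \<noteq> {} \<longrightarrow> real (card E) \<le> c * real n \<longrightarrow>
      (2 * k - 3) * card E < 2 * card (\<Union>p\<in>E. set (slot_edge k n \<tau> p)))" if n: "n > 0" for n
  proof (rule ccontr)
    assume neg: "\<not> ?thesis"
    let ?\<Omega> = "{\<tau>. \<tau> permutes {..<D * n * k}}"
    define B where "B E V = {\<tau>\<in>?\<Omega>. (\<Union>p\<in>E. set (slot_edge k n \<tau> p)) \<subseteq> V}" for E V
    define S where "S = nat \<lfloor>c * real n\<rfloor>"
    \<comment> \<open>The largest number of vertices that a bad set of \<open>s\<close> edges can
      cover. A smaller cover is padded to exactly this size, so that for each \<open>s\<close> the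
      union ranges over vertex sets of a single size; \<open>vn\<close> ensures that there is room
      for the padding.\<close>
    define v where "v s = (2 * k - 3) * s div 2" for s :: nat
    define EE where "EE s = {E. E \<subseteq> {..<D * n} \<and> card E = s}" for s
    define VV where "VV s = {V. V \<subseteq> {..<n} \<and> card V = v s}" for s
    have sS: "real s \<le> c * real n" if "s \<le> S" for s
    proof -
      have "real S \<le> c * real n" unfolding S_def using c by simp
      then show ?thesis using that by linarith
    qed
    have ksn: "real (k * s) / real n \<le> (1 / (3 * K))\<^sup>2" if "s \<le> S" for s
    proof -
      have "real k * real s \<le> real k * (c * real n)"
        using sS[OF that] by (intro mult_left_mono) auto
      also have "\<dots> = (1 / (3 * K))\<^sup>2 * real n" by (simp flip: kc)
      finally show ?thesis using n by (simp add: divide_le_eq)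
    qed
    have kn: "k * s \<le> n" if "s \<le> S" for s
    proof -
      have "(1 / (3 * K))\<^sup>2 \<le> 1" using K by (intro power_le_one) auto
      then have "real (k * s) / real n \<le> 1" using ksn[OF that] by linarith
      then have "real (k * s) \<le> real n" using n by (simp add: divide_le_eq)
      then show ?thesis by linarith
    qed
    have vn: "v s \<le> n" if "s \<le> S" for s
    proof -
      have "(2 * k - 3) * s \<le> 2 * k * s" by (intro mult_le_mono1) simp
      then have "v s \<le> k * s" unfolding v_def by linarith
      then show ?thesis using kn[OF that] by simp
    qed
    have fEE: "finite (EE s)" for s by (simp add: EE_def)
    have fVV: "finite (VV s)" for s by (simp add: VV_def)
    have "?\<Omega> \<subseteq> (\<Union>s\<in>{1..S}. \<Union>E\<in>EE s. \<Union>V\<in>VV s. B E V)"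
    proof
      fix \<tau> assume \<tau>: "\<tau> \<in> ?\<Omega>"
      then obtain E where E: "E \<subseteq> {..<D * n}" "E \<noteq> {}" "real (card E) \<le> c * real n"
        "2 * card (\<Union>p\<in>E. set (slot_edge k n \<tau> p)) \<le> (2 * k - 3) * card E"
        using neg by (auto simp: not_less)
      define s where "s = card E"
      have "finite E" using E(1) finite_subset by auto
      then have s: "s \<in> {1..S}"
        using E(2,3) by (auto simp: s_def S_def Suc_le_eq card_gt_0_iff le_nat_floor)
      have cov: "(\<Union>p\<in>E. set (slot_edge k n \<tau> p)) \<subseteq> {..<n}"
        using n by (auto simp: slot_edge_def)
      have "card (\<Union>p\<in>E. set (slot_edge k n \<tau> p)) \<le> v s"
        using E(4) by (simp add: v_def s_def)
      then obtain V where "(\<Union>p\<in>E. set (slot_edge k n \<tau> p)) \<subseteq> V" "V \<subseteq> {..<n}" "card V = v s"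
        using exists_subset_between[OF _ _ cov, of "v s"] vn[of s] s by auto
      then have "\<tau> \<in> B E V" "V \<in> VV s" "E \<in> EE s"
        using \<tau> E(1) by (auto simp: B_def VV_def EE_def s_def)
      then show "\<tau> \<in> (\<Union>s\<in>{1..S}. \<Union>E\<in>EE s. \<Union>V\<in>VV s. B E V)" using s by blast
    qed
    moreover have "finite (B E V)" for E V
      unfolding B_def by (rule finite_subset[OF _ finite_permutations[of "{..<D * n * k}"]]) auto
    ultimately have "card ?\<Omega> \<le> card (\<Union>s\<in>{1..S}. \<Union>E\<in>EE s. \<Union>V\<in>VV s. B E V)"
      using fEE fVV by (intro card_mono) auto
    also have "\<dots> \<le> (\<Sum>s\<in>{1..S}. \<Sum>E\<in>EE s. \<Sum>V\<in>VV s. card (B E V))"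
      by (intro order_trans[OF card_UN_le] sum_mono fEE fVV order_refl finite_atLeastAtMost)
    finally have "fact (D * n * k) \<le> (\<Sum>s\<in>{1..S}. \<Sum>E\<in>EE s. \<Sum>V\<in>VV s. card (B E V))"
      using card_permutations[of "{..<D * n * k}" "D * n * k"] by simp
    then have "real (fact (D * n * k)) \<le> real (\<Sum>s\<in>{1..S}. \<Sum>E\<in>EE s. \<Sum>V\<in>VV s. card (B E V))"
      by (simp only: of_nat_le_iff)
    also have "\<dots> = (\<Sum>s\<in>{1..S}. \<Sum>E\<in>EE s. \<Sum>V\<in>VV s. real (card (B E V)))"
      by simp
    also have "\<dots> \<le> (\<Sum>s\<in>{1..S}. \<Sum>E\<in>EE s. \<Sum>V\<in>VV s.
        fact (D * n * k) * (real (v s) / real n) ^ (k * s))"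
    proof (intro sum_mono)
      fix s E V assume "E \<in> EE s" "V \<in> VV s"
      then show "real (card (B E V)) \<le> fact (D * n * k) * (real (v s) / real n) ^ (k * s)"
        using card_bad_permutations_le[of E D n V k] assms n
        by (simp add: EE_def VV_def B_def)
    qed
    also have "\<dots> = (\<Sum>s\<in>{1..S}. fact (D * n * k) *
        (real (D * n choose s) * real (n choose v s) * (real (v s) / real n) ^ (k * s)))"
      by (simp add: EE_def VV_def n_subsets mult_ac)
    also have "\<dots> \<le> (\<Sum>s\<in>{1..S}. fact (D * n * k) * (1 / 3) ^ s)"
    proof (intro sum_mono mult_left_mono)
      fix s assume s: "s \<in> {1..S}"
      have "real (D * n choose s) * real (n choose v s) * (real (v s) / real n) ^ (k * s)
          \<le> (K * sqrt (real (k * s) / real n)) ^ s"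
        unfolding K_def using assms n s kn by (intro union_bound_term_le) (auto simp: v_def)
      also have "\<dots> \<le> (1 / 3) ^ s"
      proof (intro power_mono)
        have "sqrt (real (k * s) / real n) \<le> 1 / (3 * K)"
          using ksn[of s] s K by (intro real_le_lsqrt) auto
        then have "K * sqrt (real (k * s) / real n) \<le> K * (1 / (3 * K))"
          using K by (intro mult_left_mono) auto
        then show "K * sqrt (real (k * s) / real n) \<le> 1 / 3" using K by simp
      qed (use K in auto)
      finally show "real (D * n choose s) * real (n choose v s) * (real (v s) / real n) ^ (k * s)
          \<le> (1 / 3) ^ s" .
    qed simp
    also have "\<dots> = fact (D * n * k) * (\<Sum>s\<in>{1..S}. (1 / 3) ^ s)"
      by (simp add: sum_distrib_left)
    also have "(\<Sum>s\<in>{1..S}. (1 / 3) ^ s) = (1 - (1 / 3 :: real) ^ S) / 2"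
    proof (induction S)
      case (Suc r)
      then show ?case by simp
    qed simp
    also have "fact (D * n * k) * ((1 - (1 / 3 :: real) ^ S) / 2) < fact (D * n * k) * 1"
    proof (rule mult_strict_left_mono)
      have half: "(1 - x) / 2 < 1" if "0 < x" for x :: real using that by simp
      show "(1 - (1 / 3 :: real) ^ S) / 2 < 1" by (rule half[OF zero_less_power]) simp
    qed simp
    finally show False by simp
  qed
  then show ?thesis using c by blast
qed

text \<open>Exactly \<open>k * D\<close> values are congruent to \<open>x\<close> modulo
  \<open>n\<close>, and \<open>inv \<tau>\<close> returns each of them to one slot, hence to one
  edge. Repetitions of \<open>x\<close> within an edge only lower the count.\<close>

lemma slot_edge_degree_le:
  assumes "\<tau> permutes {..<D * n * k}" "x < n"
  shows "card {p. p < D * n \<and> x \<in> set (slot_edge k n \<tau> p)} \<le> k * D"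
proof -
  let ?Z = "{z. z < (D * k) * n \<and> z mod n \<in> {x}}"
  have Z: "card ?Z = k * D" using card_mod_preimage[of "{x}" n "D * k"] assms(2) by simp
  have "{p. p < D * n \<and> x \<in> set (slot_edge k n \<tau> p)} \<subseteq> (\<lambda>z. inv \<tau> z div k) ` ?Z"
  proof safe
    fix p assume p: "p < D * n" "x \<in> set (slot_edge k n \<tau> p)"
    then obtain i where i: "i < k" "\<tau> (p * k + i) mod n = x" by (auto simp: slot_edge_def)
    have "p * k + i < Suc p * k" using i by simp
    also have "\<dots> \<le> D * n * k" using p(1) by (intro mult_le_mono1) simp
    finally have "\<tau> (p * k + i) < D * n * k" using permutes_in_image[OF assms(1), of "p * k + i"] by simp
    then have "\<tau> (p * k + i) \<in> ?Z" using i by (simp add: mult_ac)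
    moreover have "inv \<tau> (\<tau> (p * k + i)) div k = p"
      using permutes_inverses(2)[OF assms(1)] i by simp
    ultimately show "p \<in> (\<lambda>z. inv \<tau> z div k) ` ?Z" by (intro image_eqI) simp_all
  qed
  then have "card {p. p < D * n \<and> x \<in> set (slot_edge k n \<tau> p)} \<le> card ?Z"
    by (intro surj_card_le) auto
  then show ?thesis using Z by simp
qed

section \<open>Local satisfiability\<close>

lemma hamming_weight_eq_card: "hamming_weight x = card {p. p < length x \<and> x ! p}"
  by (simp add: hamming_weight_def count_list_eq_length_filter length_filter_conv_card)

text \<open>Some satisfying input is not constant, so its weight \<open>w0\<close> lies strictly
  between 0 and \<open>k\<close>; by symmetry every input of weight \<open>w0\<close> or
  \<open>k - w0\<close> satisfies \<open>P\<close>. Since \<open>k \<ge> 3\<close>, one of these two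
  weights is compatible with any two prescribed bits.\<close>

lemma symmetric_pred_extension:
  assumes "k \<ge> 3" "card {x \<in> cube k. P x} > 0" "symmetric_pred k P"
    "\<exists>x\<in>cube k. P x \<noteq> EQU x"
    and G: "G \<subseteq> {..<k}" "card G \<le> 2"
  shows "\<exists>x\<in>cube k. P x \<and> (\<forall>p\<in>G. x ! p = y p)"
proof -
  have sw: "P u = P v" if "u \<in> cube k" "v \<in> cube k" "hamming_weight u = hamming_weight v" for u v
    using assms(3) that unfolding symmetric_pred_def by blast
  have sn: "P u = P (map Not u)" if "u \<in> cube k" for u
    using assms(3) that unfolding symmetric_pred_def by blast
  have wn: "hamming_weight (map Not u) = k - hamming_weight u" if "u \<in> cube k" for u
  proof -
    have "{p. p < length (map Not u) \<and> map Not u ! p} = {..<k} - {p. p < length u \<and> u ! p}"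
      using that by (auto simp: cube_def)
    moreover have "{p. p < length u \<and> u ! p} \<subseteq> {..<k}" using that by (auto simp: cube_def)
    ultimately show ?thesis
      by (simp only: hamming_weight_eq_card card_Diff_subset finite_subset[OF _ finite_lessThan] card_lessThan)
  qed
  have wk: "hamming_weight u \<le> k" if "u \<in> cube k" for u
    using that count_le_length[of u True] by (simp only: hamming_weight_def cube_def mem_Collect_eq)
  have equ: "EQU u \<longleftrightarrow> hamming_weight u = 0 \<or> hamming_weight u = k" if "u \<in> cube k" for u
  proof -
    have "EQU u \<longleftrightarrow> (True \<notin> set u \<or> False \<notin> set u)"
      unfolding EQU_def by (metis (full_types))
    moreover have "hamming_weight u = 0 \<longleftrightarrow> True \<notin> set u"
      unfolding hamming_weight_def by (simp add: count_list_0_iff)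
    moreover have "False \<notin> set u \<longleftrightarrow> True \<notin> set (map Not u)"
      by (induction u) auto
    moreover have "True \<notin> set (map Not u) \<longleftrightarrow> hamming_weight (map Not u) = 0"
      unfolding hamming_weight_def by (simp add: count_list_0_iff)
    ultimately have "EQU u \<longleftrightarrow> hamming_weight u = 0 \<or> hamming_weight (map Not u) = 0"
      by simp
    then show ?thesis unfolding wn[OF that] using wk[OF that] by linarith
  qed
  have "{x \<in> cube k. P x} \<noteq> {}" using assms(2) by (metis card.empty less_irrefl)
  then obtain x1 where x1: "x1 \<in> cube k" "P x1" by blast
  \<comment> \<open>Otherwise only constant inputs satisfy \<open>P\<close>. One of them does, hence
    so does its complement, and \<open>P\<close> would be \<open>k\<close>-EQU.\<close>
  have "\<exists>x0\<in>cube k. P x0 \<and> \<not> EQU x0"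
  proof (rule ccontr)
    assume c: "\<not> ?thesis"
    then obtain x where x: "x \<in> cube k" "EQU x" "\<not> P x"
      using assms(4) by blast
    have e1: "EQU x1" using c x1 by blast
    have "hamming_weight x = hamming_weight x1 \<or> hamming_weight x = hamming_weight (map Not x1)"
      using e1 x equ[OF x1(1)] equ[OF x(1)] wn[OF x1(1)] by auto
    then have "P x = P x1"
      using sw[OF x(1) x1(1)] sw[OF x(1), of "map Not x1"] sn[OF x1(1)] x1(1) by (auto simp: cube_def)
    then show False using x x1 by simp
  qed
  then obtain x0 where x0: "x0 \<in> cube k" "P x0" "\<not> EQU x0" by blast
  define w0 where "w0 = hamming_weight x0"
  have w0: "0 < w0" "w0 < k" using equ[OF x0(1)] wk[OF x0(1)] x0(3) by (auto simp: w0_def)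
  have good: "P u" if u: "u \<in> cube k" and wu: "hamming_weight u = w0 \<or> hamming_weight u = k - w0" for u
    using wu
  proof
    assume "hamming_weight u = w0"
    then show ?thesis using sw[OF u x0(1)] x0(2) by (simp add: w0_def)
  next
    assume "hamming_weight u = k - w0"
    moreover have "map Not x0 \<in> cube k" using x0(1) by (simp add: cube_def)
    ultimately show ?thesis
      using sw[OF u, of "map Not x0"] sn[OF x0(1)] wn[OF x0(1)] x0(2) by (simp only: w0_def)
  qed
  define T where "T = {p\<in>G. y p}"
  have finG: "finite G" using G finite_subset by auto
  have "T \<subseteq> G" by (auto simp: T_def)
  then have cT: "card T + card (G - T) = card G"
    using finG by (simp add: card_Diff_subset finite_subset card_mono)
  \<comment> \<open>With at most two prescribed bits, \<open>w0\<close> fails only if both are equal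
    and \<open>w0\<close> leaves room for just one of that kind; then \<open>k - w0\<close> leaves
    room for \<open>k - 1 \<ge> 2\<close> of them.\<close>
  obtain w where w: "w = w0 \<or> w = k - w0" "card T \<le> w" "w \<le> k - card (G - T)"
  proof (cases "card T \<le> w0 \<and> w0 \<le> k - card (G - T)")
    case False
    then have "card T \<le> k - w0 \<and> k - w0 \<le> k - card (G - T)"
      using cT G(2) w0 assms(1) by linarith
    then show ?thesis using that by blast
  qed (use that in blast)
  have "card ({..<k} - (G - T)) = k - card (G - T)"
    using finG G by (subst card_Diff_subset) auto
  then obtain W where W: "T \<subseteq> W" "W \<subseteq> {..<k} - (G - T)" "card W = w"
    using exists_subset_between[of T w "{..<k} - (G - T)"] w G by (auto simp: T_def)
  define x where "x = map (\<lambda>p. p \<in> W) [0..<k]"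
  have "{p. p < length x \<and> x ! p} = W" using W by (auto simp: x_def)
  then have "hamming_weight x = w" using W by (simp add: hamming_weight_eq_card)
  moreover have "x \<in> cube k" by (simp add: x_def cube_def)
  moreover have "x ! p = y p" if "p \<in> G" for p
  proof -
    have "p < k" using that G by auto
    then have "x ! p = (p \<in> W)" by (simp add: x_def)
    also have "\<dots> = y p" using that W by (auto simp: T_def)
    finally show ?thesis .
  qed
  ultimately show ?thesis using good w(1) by blast
qed

text \<open>Count incidences with multiplicity: there are \<open>k * card S\<close>, and every
  vertex outside \<open>U\<close> accounts for at least two, so
  \<open>2 * card V \<le> k * card S + card U\<close>. If each edge had at most \<open>k - 3\<close>
  vertices of \<open>U\<close>, then \<open>2 * card V \<le> (2 * k - 3) * card S\<close>, against
  the expansion.\<close>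

lemma exists_edge_with_private_vertices:
  fixes e :: "'i \<Rightarrow> 'v list"
  assumes "finite S" "k \<ge> 3" "\<And>i. i \<in> S \<Longrightarrow> length (e i) = k"
    and exp: "(2 * k - 3) * card S < 2 * card (\<Union>i\<in>S. set (e i))"
  shows "\<exists>i\<in>S. \<exists>U. U \<subseteq> set (e i) \<and> k - 2 \<le> card U \<and> (\<forall>v\<in>U. count_list (e i) v = 1) \<and>
           (\<forall>j\<in>S - {i}. U \<inter> set (e j) = {})"
proof (rule ccontr)
  assume neg: "\<not> ?thesis"
  define V where "V = (\<Union>i\<in>S. set (e i))"
  define occ where "occ v = (\<Sum>i\<in>S. count_list (e i) v)" for v
  define U where "U = {v\<in>V. occ v = 1}"
  have finV: "finite V" using assms(1) by (simp add: V_def)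
  have split: "count_list (e i) v + (\<Sum>j\<in>S - {i}. count_list (e j) v) = occ v" if "i \<in> S" for i v
    unfolding occ_def by (rule sum.remove[OF assms(1) that, symmetric])
  have pos: "1 \<le> count_list (e i) v" if "v \<in> set (e i)" for i v
    using that by (metis count_list_0_iff less_one not_le)
  have occ_pos: "1 \<le> occ v" if v: "v \<in> V" for v
  proof -
    obtain i where "i \<in> S" "v \<in> set (e i)" using v by (auto simp: V_def)
    then show ?thesis using split[of i v] pos[of v i] by linarith
  qed
  have "(\<Sum>v\<in>V. occ v) = (\<Sum>i\<in>S. \<Sum>v\<in>V. count_list (e i) v)"
    unfolding occ_def by (rule sum.swap)
  also have "\<dots> = (\<Sum>i\<in>S. k)"
  proof (rule sum.cong[OF refl])
    fix i assume i: "i \<in> S"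
    have "(\<Sum>v\<in>V. count_list (e i) v) = (\<Sum>v\<in>set (e i). count_list (e i) v)"
      using i finV by (intro sum.mono_neutral_right) (auto simp: V_def)
    then show "(\<Sum>v\<in>V. count_list (e i) v) = k"
      using sum_count_set[of "e i" "set (e i)"] assms(3)[OF i] by simp
  qed
  finally have tot: "(\<Sum>v\<in>V. occ v) = k * card S" by simp
  have "2 * card V = (\<Sum>v\<in>V. 2)" by simp
  also have "\<dots> \<le> (\<Sum>v\<in>V. occ v + (if v \<in> U then 1 else 0))"
  proof (rule sum_mono)
    fix v assume "v \<in> V"
    then show "2 \<le> occ v + (if v \<in> U then 1 else 0)" using occ_pos[of v] by (auto simp: U_def)
  qed
  also have "\<dots> = k * card S + card U"
    using finV by (simp add: sum.distrib tot sum.If_cases U_def Int_def)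
  finally have ge: "2 * card V \<le> k * card S + card U" .
  have "card U \<le> (\<Sum>i\<in>S. card (U \<inter> set (e i)))"
  proof -
    have "U = (\<Union>i\<in>S. U \<inter> set (e i))" by (auto simp: U_def V_def)
    then show ?thesis using card_UN_le[OF assms(1)] by metis
  qed
  also have "\<dots> \<le> (\<Sum>i\<in>S. k - 3)"
  proof (rule sum_mono)
    fix i assume i: "i \<in> S"
    \<comment> \<open>A total multiplicity of 1 is used up by one occurrence in edge
      \<open>i\<close>, so the vertex appears in no other edge.\<close>
    have one: "count_list (e i) v = 1 \<and> (\<forall>j\<in>S - {i}. v \<notin> set (e j))"
      if v: "v \<in> U \<inter> set (e i)" for v
    proof -
      have "occ v = 1" using v by (simp add: U_def)
      then have s: "count_list (e i) v = 1" "(\<Sum>j\<in>S - {i}. count_list (e j) v) = 0"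
        using split[OF i, of v] pos[of v i] v by auto
      then have "count_list (e j) v = 0" if "j \<in> S - {i}" for j
        using that assms(1) by simp
      then show ?thesis using s(1) by (simp add: count_list_0_iff)
    qed
    have "\<not> k - 2 \<le> card (U \<inter> set (e i))"
      using neg i one by blast
    then show "card (U \<inter> set (e i)) \<le> k - 3" by linarith
  qed
  finally have "card U \<le> (k - 3) * card S" by (simp add: mult.commute)
  then have "2 * card V \<le> (k + (k - 3)) * card S"
    using ge by (simp add: algebra_simps)
  also have "k + (k - 3) = 2 * k - 3" using assms(2) by simp
  finally show False using exp by (simp add: V_def)
qed

lemma sat_constraint_cong:
  assumes "\<And>v. v \<in> set vs \<Longrightarrow> a v = a' v"
  shows "sat_constraint P a (vs, bs) = sat_constraint P a' (vs, bs)"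
proof -
  have "map2 (\<lambda>v b. a v \<noteq> b) vs bs = map2 (\<lambda>v b. a' v \<noteq> b) vs bs"
    by (rule map_cong) (auto dest!: set_zip_leftD simp: assms)
  then show ?thesis by (simp only: sat_constraint_def fst_conv snd_conv)
qed

text \<open>Peel off an edge with \<open>k - 2\<close> private vertices, satisfy the rest by
  induction, and then repair the removed edge by changing its private vertices only. Expansion is
  assumed for all nonempty subsets, so it survives the removal.\<close>

lemma expanding_satisfiable:
  fixes e :: "'i \<Rightarrow> nat list"
  assumes P: "k \<ge> 3" "card {x \<in> cube k. P x} > 0" "symmetric_pred k P"
    "\<exists>x\<in>cube k. P x \<noteq> EQU x"
    and "finite S" "\<And>i. i \<in> S \<Longrightarrow> length (e i) = k" "\<And>i. i \<in> S \<Longrightarrow> length (b i) = k"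
    and "\<And>S'. S' \<subseteq> S \<Longrightarrow> S' \<noteq> {} \<Longrightarrow> (2 * k - 3) * card S' < 2 * card (\<Union>i\<in>S'. set (e i))"
  shows "\<exists>a. \<forall>i\<in>S. sat_constraint P a (e i, b i)"
  using assms(5-)
proof (induction "card S" arbitrary: S)
  case 0
  then show ?case by simp
next
  case (Suc r)
  then have "S \<noteq> {}" by auto
  then obtain i U where i: "i \<in> S" and U: "U \<subseteq> set (e i)" "k - 2 \<le> card U"
      "\<And>v. v \<in> U \<Longrightarrow> count_list (e i) v = 1" "\<And>j. j \<in> S - {i} \<Longrightarrow> U \<inter> set (e j) = {}"
    using exists_edge_with_private_vertices[of S k e] Suc.prems P(1) by (metis order_refl)
  have "\<exists>a. \<forall>j\<in>S - {i}. sat_constraint P a (e j, b j)"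
  proof (rule Suc.hyps(1))
    show "r = card (S - {i})" using Suc.hyps(2) i by simp
    show "(2 * k - 3) * card S' < 2 * card (\<Union>i\<in>S'. set (e i))" if "S' \<subseteq> S - {i}" "S' \<noteq> {}" for S'
      using that by (intro Suc.prems(4)) auto
  qed (use Suc.prems in auto)
  then obtain a0 where a0: "\<And>j. j \<in> S - {i} \<Longrightarrow> sat_constraint P a0 (e j, b j)" by blast
  have len: "length (e i) = k" "length (b i) = k" using Suc.prems i by auto
  \<comment> \<open>\<open>F\<close> collects the positions free to be changed; the values at the at
    most two positions in \<open>G\<close> are dictated by \<open>a0\<close>.\<close>
  define F where "F = {p. p < k \<and> e i ! p \<in> U}"
  define G where "G = {..<k} - F"
  have "U = (\<lambda>p. e i ! p) ` F"
    using U(1) len by (force simp: F_def in_set_conv_nth)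
  moreover have "finite F" by (simp add: F_def)
  ultimately have "card U \<le> card F" using card_image_le by blast
  then have "k - 2 \<le> card F" using U(2) by simp
  moreover have "card G = k - card F"
    unfolding G_def by (subst card_Diff_subset) (auto simp: F_def)
  ultimately have G: "G \<subseteq> {..<k}" "card G \<le> 2" by (auto simp: G_def)
  obtain x where x: "x \<in> cube k" "P x" "\<And>p. p \<in> G \<Longrightarrow> x ! p = (a0 (e i ! p) \<noteq> b i ! p)"
    using symmetric_pred_extension[OF P G, of "\<lambda>p. a0 (e i ! p) \<noteq> b i ! p"] by blast
  have uniq: "p = q" if "p < k" "q < k" "e i ! p = e i ! q" "e i ! p \<in> U" for p q
  proof (rule ccontr)
    assume "p \<noteq> q"
    then have "card {p, q} = 2" by simp
    moreover have "{p, q} \<subseteq> {r. r < length (e i) \<and> e i ! p = e i ! r}"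
      using that len by auto
    ultimately have "2 \<le> count_list (e i) (e i ! p)"
      using card_mono[of "{r. r < length (e i) \<and> e i ! p = e i ! r}" "{p, q}"]
      unfolding count_list_eq_length_filter length_filter_conv_card by simp
    then show False using U(3)[OF that(4)] by simp
  qed
  \<comment> \<open>By \<open>uniq\<close> a private vertex sits at a single position
    \<open>p\<close>, so setting it to the sum of \<open>x ! p\<close> and the sign there is
    consistent.\<close>
  define a where "a v = (if v \<in> U then \<exists>p<k. e i ! p = v \<and> x ! p \<noteq> b i ! p else a0 v)" for v
  have "map2 (\<lambda>v b. a v \<noteq> b) (e i) (b i) = x"
  proof (rule nth_equalityI)
    show "length (map2 (\<lambda>v b. a v \<noteq> b) (e i) (b i)) = length x"
      using len x(1) by (simp add: cube_def)
    fix p assume "p < length (map2 (\<lambda>v b. a v \<noteq> b) (e i) (b i))"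
    then have p: "p < k" using len by simp
    have "(a (e i ! p) \<noteq> b i ! p) = x ! p"
    proof (cases "e i ! p \<in> U")
      case True
      then have "a (e i ! p) = (x ! p \<noteq> b i ! p)"
        using uniq p by (auto simp: a_def)
      then show ?thesis by auto
    next
      case False
      then have "p \<in> G" using p by (simp add: G_def F_def)
      then show ?thesis using x(3) False by (simp add: a_def)
    qed
    then show "map2 (\<lambda>v b. a v \<noteq> b) (e i) (b i) ! p = x ! p"
      using p len by simp
  qed
  then have "sat_constraint P a (e i, b i)" using x(2) by (simp add: sat_constraint_def)
  moreover have "sat_constraint P a (e j, b j)" if "j \<in> S - {i}" for j
    using a0[OF that] U(4)[OF that]
    by (subst sat_constraint_cong[of _ _ a0]) (auto simp: a_def)
  ultimately show ?case by blast
qed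

section \<open>Random signs\<close>

lemma finite_cube: "finite (cube k)"
  using finite_lists_length_eq[of "UNIV :: bool set" k] by (simp add: cube_def)

lemma card_cube: "card (cube k) = 2 ^ k"
  using card_lists_length_eq[of "UNIV :: bool set" k] by (simp add: cube_def)

text \<open>For a fixed assignment, adding its values is an involution of the cube, so uniform signs
  feed a uniform input to \<open>P\<close>.\<close>

lemma sum_over_signs:
  fixes f :: "bool list \<Rightarrow> real"
  assumes "length vs = k"
  shows "(\<Sum>b\<in>cube k. f (map2 (\<lambda>v b. a v \<noteq> b) vs b)) = (\<Sum>x\<in>cube k. f x)"
proof (rule sum.reindex_bij_betw)
  have inv: "map2 (\<lambda>v b. a v \<noteq> b) vs (map2 (\<lambda>v b. a v \<noteq> b) vs b) = b" if "length b = k" for b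
    using that assms by (intro nth_equalityI) auto
  show "bij_betw (map2 (\<lambda>v b. a v \<noteq> b) vs) (cube k) (cube k)"
    by (rule bij_betwI[where g = "map2 (\<lambda>v b. a v \<noteq> b) vs"])
       (use inv assms in \<open>auto simp: cube_def\<close>)
qed

text \<open>The left side is the moment generating function at -\<eta> of a Bernoulli variable with
  mean \<rho>. The quadratic bound on exp(-\<eta>) holds because the product of 1 - \<eta> +
  \<eta>^2/2 and 1 + \<eta> + \<eta>^2/2 is 1 + \<eta>^4/4.\<close>

lemma tilted_average_le:
  fixes \<rho> \<eta> :: real
  assumes "0 \<le> \<rho>" "\<rho> \<le> 1" "0 \<le> \<eta>"
  shows "1 - \<rho> + \<rho> * exp (- \<eta>) \<le> exp (- (\<rho> * \<eta>) + \<eta>\<^sup>2 / 2)"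
proof -
  have e: "exp (- \<eta>) \<le> 1 - \<eta> + \<eta>\<^sup>2 / 2"
  proof -
    have "1 * 1 \<le> (1 - \<eta> + \<eta>\<^sup>2 / 2) * (1 + \<eta> + \<eta>\<^sup>2 / 2)"
      using assms(3) by (simp add: algebra_simps power2_eq_square)
    also have "\<dots> \<le> (1 - \<eta> + \<eta>\<^sup>2 / 2) * exp \<eta>"
    proof (rule mult_left_mono)
      show "1 + \<eta> + \<eta>\<^sup>2 / 2 \<le> exp \<eta>" using assms(3) by (rule exp_lower_Taylor_quadratic)
      have "0 \<le> (1 - \<eta>)\<^sup>2 + 1" by simp
      also have "\<dots> = 2 * (1 - \<eta> + \<eta>\<^sup>2 / 2)" by (simp add: algebra_simps power2_eq_square)
      finally show "0 \<le> 1 - \<eta> + \<eta>\<^sup>2 / 2" by simp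
    qed
    finally show ?thesis by (simp add: exp_minus field_simps)
  qed
  have "1 - \<rho> + \<rho> * exp (- \<eta>) \<le> 1 - \<rho> + \<rho> * (1 - \<eta> + \<eta>\<^sup>2 / 2)"
    using mult_left_mono[OF e assms(1)] by simp
  also have "\<dots> = 1 + (- (\<rho> * \<eta>) + \<rho> * (\<eta>\<^sup>2 / 2))" by (simp add: algebra_simps)
  also have "\<dots> \<le> 1 + (- (\<rho> * \<eta>) + \<eta>\<^sup>2 / 2)"
    using mult_right_mono[OF assms(2), of "\<eta>\<^sup>2 / 2"] by simp
  also have "\<dots> \<le> exp (- (\<rho> * \<eta>) + \<eta>\<^sup>2 / 2)" by (rule exp_ge_add_one_self)
  finally show ?thesis .
qed

text \<open>A Chernoff bound for the lower tail of the number of violations, in counting form. The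
  tilt parameter is \<epsilon> itself, which leaves exp(-\<epsilon>^2/2) per constraint.\<close>

lemma card_few_violations_le:
  fixes \<epsilon> :: real and P :: "bool list \<Rightarrow> bool"
  assumes "\<And>p. p < m \<Longrightarrow> length (e p) = k" "0 \<le> \<epsilon>"
  defines "\<rho> \<equiv> real (card {x \<in> cube k. \<not> P x}) / 2 ^ k"
  shows "real (card {b \<in> {..<m} \<rightarrow>\<^sub>E cube k.
        real (card {p. p < m \<and> \<not> sat_constraint P a (e p, b p)}) < (\<rho> - \<epsilon>) * real m})
    \<le> 2 ^ (k * m) * exp (- (\<epsilon>\<^sup>2 / 2)) ^ m"
    (is "real (card ?B) \<le> _")
proof -
  define w where "w x = exp (- \<epsilon> * of_bool (\<not> P x))" for x
  define viol where "viol b = card {p. p < m \<and> \<not> sat_constraint P a (e p, b p)}" for b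
  have fin: "finite ({..<m} \<rightarrow>\<^sub>E cube k)" by (intro finite_PiE finite_cube finite_lessThan)
  have \<rho>: "0 \<le> \<rho>" "\<rho> \<le> 1"
  proof -
    have "card {x \<in> cube k. \<not> P x} \<le> 2 ^ k"
      unfolding card_cube[symmetric] by (intro card_mono finite_cube) auto
    then have "real (card {x \<in> cube k. \<not> P x}) \<le> real (2 ^ k)" by (simp only: of_nat_le_iff)
    then show "\<rho> \<le> 1" by (simp add: \<rho>_def)
  qed (simp add: \<rho>_def)
  have avg: "(\<Sum>x\<in>cube k. w x) = 2 ^ k * (1 - \<rho> + \<rho> * exp (- \<epsilon>))"
  proof -
    have "(\<Sum>x\<in>cube k. w x) = (\<Sum>x\<in>cube k. 1 - (1 - exp (- \<epsilon>)) * of_bool (\<not> P x))"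
      by (intro sum.cong) (auto simp: w_def)
    also have "\<dots> = 2 ^ k - (1 - exp (- \<epsilon>)) * real (card {x \<in> cube k. \<not> P x})"
      by (simp add: sum_subtractf card_cube flip: sum_distrib_left)
         (simp add: of_bool_def sum.If_cases finite_cube Int_def)
    also have "\<dots> = 2 ^ k * (1 - \<rho> + \<rho> * exp (- \<epsilon>))"
      by (simp add: \<rho>_def field_simps)
    finally show ?thesis .
  qed
  have mgf: "(\<Sum>b\<in>{..<m} \<rightarrow>\<^sub>E cube k. exp (- \<epsilon> * real (viol b))) = (2 ^ k * (1 - \<rho> + \<rho> * exp (- \<epsilon>))) ^ m"
  proof -
    have "exp (- \<epsilon> * real (viol b)) = (\<Prod>p<m. w (map2 (\<lambda>v b. a v \<noteq> b) (e p) (b p)))" for b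
    proof -
      have "real (viol b) = (\<Sum>p<m. of_bool (\<not> sat_constraint P a (e p, b p)))"
        by (simp add: viol_def of_bool_def sum.If_cases Int_def lessThan_def)
      then have "exp (- \<epsilon> * real (viol b)) = exp (\<Sum>p<m. - \<epsilon> * of_bool (\<not> sat_constraint P a (e p, b p)))"
        by (simp only: sum_distrib_left)
      also have "\<dots> = (\<Prod>p<m. exp (- \<epsilon> * of_bool (\<not> sat_constraint P a (e p, b p))))"
        by (rule exp_sum) simp
      finally show ?thesis by (simp only: w_def sat_constraint_def fst_conv snd_conv)
    qed
    then have "(\<Sum>b\<in>{..<m} \<rightarrow>\<^sub>E cube k. exp (- \<epsilon> * real (viol b))) =
        (\<Sum>b\<in>{..<m} \<rightarrow>\<^sub>E cube k. \<Prod>p<m. w (map2 (\<lambda>v b. a v \<noteq> b) (e p) (b p)))"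
      by (simp only:)
    \<comment> \<open>Independence of the signs of different constraints: the sum over all sign
      choices factorizes.\<close>
    also have "\<dots> = (\<Prod>p<m. \<Sum>b\<in>cube k. w (map2 (\<lambda>v b. a v \<noteq> b) (e p) b))"
      by (rule prod_sum_PiE[symmetric]) (auto simp: finite_cube)
    also have "\<dots> = (\<Prod>p<m. \<Sum>x\<in>cube k. w x)"
      by (intro prod.cong refl sum_over_signs assms(1)) auto
    finally show ?thesis by (simp add: avg)
  qed
  have "real (card ?B) * exp (- \<epsilon> * ((\<rho> - \<epsilon>) * real m)) = (\<Sum>b\<in>?B. exp (- \<epsilon> * ((\<rho> - \<epsilon>) * real m)))"
    by simp
  also have "\<dots> \<le> (\<Sum>b\<in>?B. exp (- \<epsilon> * real (viol b)))"
  proof (rule sum_mono)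
    fix b assume "b \<in> ?B"
    then have "real (viol b) \<le> (\<rho> - \<epsilon>) * real m" by (simp add: viol_def)
    then show "exp (- \<epsilon> * ((\<rho> - \<epsilon>) * real m)) \<le> exp (- \<epsilon> * real (viol b))"
      using assms(2) mult_left_mono[of "real (viol b)" _ \<epsilon>] by simp
  qed
  also have "\<dots> \<le> (\<Sum>b\<in>{..<m} \<rightarrow>\<^sub>E cube k. exp (- \<epsilon> * real (viol b)))"
    using fin by (intro sum_mono2) auto
  also have "\<dots> \<le> (2 ^ k * exp (- (\<rho> * \<epsilon>) + \<epsilon>\<^sup>2 / 2)) ^ m"
    unfolding mgf using \<rho> assms(2)
    by (intro power_mono mult_left_mono tilted_average_le) auto
  finally have le: "real (card ?B) * exp (- \<epsilon> * ((\<rho> - \<epsilon>) * real m)) \<le>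
      (2 ^ k * exp (- (\<rho> * \<epsilon>) + \<epsilon>\<^sup>2 / 2)) ^ m" .
  have "real (card ?B) = real (card ?B) * exp (- \<epsilon> * ((\<rho> - \<epsilon>) * real m)) * exp (\<epsilon> * (\<rho> - \<epsilon>)) ^ m"
    by (simp add: exp_add[symmetric] mult_ac flip: exp_of_nat_mult)
  also have "\<dots> \<le> (2 ^ k * exp (- (\<rho> * \<epsilon>) + \<epsilon>\<^sup>2 / 2)) ^ m * exp (\<epsilon> * (\<rho> - \<epsilon>)) ^ m"
    using le by (intro mult_right_mono) auto
  also have "\<dots> = 2 ^ (k * m) * (exp (- (\<rho> * \<epsilon>) + \<epsilon>\<^sup>2 / 2) * exp (\<epsilon> * (\<rho> - \<epsilon>))) ^ m"
    by (simp add: power_mult_distrib power_mult)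
  also have "exp (- (\<rho> * \<epsilon>) + \<epsilon>\<^sup>2 / 2) * exp (\<epsilon> * (\<rho> - \<epsilon>)) = exp (- (\<epsilon>\<^sup>2 / 2))"
    by (simp add: algebra_simps power2_eq_square flip: exp_add)
  finally show ?thesis .
qed

text \<open>A union bound over assignments. Only the values on the \<open>n\<close> variables
  matter, so assignments are represented by the subsets \<open>A\<close> of
  \<open>{..<n}\<close>.\<close>

lemma exists_signs_violated_by_all:
  fixes \<epsilon> :: real and P :: "bool list \<Rightarrow> bool"
  assumes "\<And>p. p < m \<Longrightarrow> length (e p) = k \<and> set (e p) \<subseteq> {..<n}" "0 \<le> \<epsilon>"
    and "2 ^ n * exp (- (\<epsilon>\<^sup>2 / 2)) ^ m < 1"
  defines "\<rho> \<equiv> real (card {x \<in> cube k. \<not> P x}) / 2 ^ k"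
  shows "\<exists>b. (\<forall>p<m. length (b p) = k) \<and>
    (\<forall>a. (\<rho> - \<epsilon>) * real m \<le> real (card {p. p < m \<and> \<not> sat_constraint P a (e p, b p)}))"
proof (rule ccontr)
  assume neg: "\<not> ?thesis"
  let ?\<Omega> = "{..<m} \<rightarrow>\<^sub>E cube k"
  define viol where "viol a b = card {p. p < m \<and> \<not> sat_constraint P a (e p, b p)}" for a b
  define B where "B A = {b\<in>?\<Omega>. real (viol (\<lambda>v. v \<in> A) b) < (\<rho> - \<epsilon>) * real m}" for A
  have fin: "finite ?\<Omega>" by (intro finite_PiE finite_cube finite_lessThan)
  have "?\<Omega> \<subseteq> (\<Union>A\<in>Pow {..<n}. B A)"
  proof
    fix b assume b: "b \<in> ?\<Omega>"
    then have "\<forall>p<m. length (b p) = k" by (auto simp: cube_def)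
    then obtain a where a: "real (viol a b) < (\<rho> - \<epsilon>) * real m"
      using neg by (auto simp: viol_def not_le)
    have "sat_constraint P a (e p, b p) = sat_constraint P (\<lambda>v. v \<in> {v. v < n \<and> a v}) (e p, b p)"
      if "p < m" for p
      using assms(1)[OF that] by (intro sat_constraint_cong) auto
    then have "viol a b = viol (\<lambda>v. v \<in> {v. v < n \<and> a v}) b"
      unfolding viol_def by (metis (mono_tags, lifting))
    then have "b \<in> B {v. v < n \<and> a v}" using a b by (simp add: B_def)
    then show "b \<in> (\<Union>A\<in>Pow {..<n}. B A)" by (rule UN_I[rotated]) auto
  qed
  then have "card ?\<Omega> \<le> card (\<Union>A\<in>Pow {..<n}. B A)"
    using fin by (intro card_mono) (auto simp: B_def)
  also have "\<dots> \<le> (\<Sum>A\<in>Pow {..<n}. card (B A))" by (rule card_UN_le) simp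
  finally have "real (card ?\<Omega>) \<le> (\<Sum>A\<in>Pow {..<n}. real (card (B A)))"
    by (simp flip: of_nat_sum)
  also have "\<dots> \<le> (\<Sum>A\<in>Pow {..<n}. 2 ^ (k * m) * exp (- (\<epsilon>\<^sup>2 / 2)) ^ m)"
    unfolding B_def viol_def \<rho>_def using assms(1,2)
    by (intro sum_mono card_few_violations_le) auto
  also have "\<dots> = 2 ^ (k * m) * (2 ^ n * exp (- (\<epsilon>\<^sup>2 / 2)) ^ m)"
    by (simp add: card_Pow)
  also have "\<dots> < 2 ^ (k * m) * 1"
    using assms(3) by (intro mult_strict_left_mono) auto
  finally show False by (simp add: card_PiE card_cube power_mult)
qed

section \<open>Query algorithms\<close>

text \<open>The positions of the constraints containing \<open>x\<close> depend only on the variable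
  tuples. Changing signs therefore alters neither the degrees nor which position a query
  reveals.\<close>

lemma constraints_on_eq_map_nth:
  "constraints_on cs x = map (nth cs) (filter (\<lambda>i. x \<in> set (map fst cs ! i)) [0..<length cs])"
proof -
  have "constraints_on cs x = filter (\<lambda>c. x \<in> set (fst c)) (map (nth cs) [0..<length cs])"
    by (simp add: constraints_on_def map_nth)
  also have "\<dots> = map (nth cs) (filter (\<lambda>i. x \<in> set (fst (cs ! i))) [0..<length cs])"
    by (simp add: filter_map o_def)
  also have "filter (\<lambda>i. x \<in> set (fst (cs ! i))) [0..<length cs] =
      filter (\<lambda>i. x \<in> set (map fst cs ! i)) [0..<length cs]"
    by (rule filter_cong) auto
  finally show ?thesis .
qed

lemma query_answer_determined:
  "\<exists>S\<subseteq>{..<length cs}. card S \<le> 1 \<and> (\<forall>cs'. map fst cs' = map fst cs \<longrightarrow>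
      (\<forall>i\<in>S. cs' ! i = cs ! i) \<longrightarrow> query_answer cs' x j = query_answer cs x j)"
proof -
  define F where "F = filter (\<lambda>i. x \<in> set (map fst cs ! i)) [0..<length cs]"
  have F: "constraints_on cs' x = map (nth cs') F" if "map fst cs' = map fst cs" for cs'
    using constraints_on_eq_map_nth[of cs' x] that map_eq_imp_length_eq[OF that]
    by (simp add: F_def)
  show ?thesis
  proof (cases "1 \<le> j \<and> j \<le> length F")
    case True
    then have "F ! (j - 1) \<in> set F" by (intro nth_mem) linarith
    then have "F ! (j - 1) < length cs" by (simp add: F_def)
    then show ?thesis using True F
      by (intro exI[of _ "{F ! (j - 1)}"]) (auto simp: query_answer_def)
  next
    case False
    then show ?thesis using F by (intro exI[of _ "{}"]) (auto simp: query_answer_def)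
  qed
qed

text \<open>\<open>S\<close> consists of the positions revealed along the run on \<open>cs\<close>.
  An instance with the same variable tuples that agrees on \<open>S\<close> follows the same branch
  of the tree.\<close>

lemma accepts_determined:
  "\<exists>S\<subseteq>{..<length cs}. card S \<le> num_queries (query_answer cs) t \<and>
     (\<forall>cs'. map fst cs' = map fst cs \<longrightarrow> (\<forall>i\<in>S. cs' ! i = cs ! i) \<longrightarrow>
        accepts (query_answer cs') t = accepts (query_answer cs) t)"
proof (induction t)
  case (Answer b)
  then show ?case by (intro exI[of _ "{}"]) auto
next
  case (Query x j f)
  obtain S where S: "S \<subseteq> {..<length cs}" "card S \<le> num_queries (query_answer cs) (f (query_answer cs x j))"
    "\<And>cs'. map fst cs' = map fst cs \<Longrightarrow> (\<forall>i\<in>S. cs' ! i = cs ! i) \<Longrightarrow>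
      accepts (query_answer cs') (f (query_answer cs x j)) = accepts (query_answer cs) (f (query_answer cs x j))"
    using Query.IH[OF rangeI] by metis
  obtain S' where S': "S' \<subseteq> {..<length cs}" "card S' \<le> 1"
    "\<And>cs'. map fst cs' = map fst cs \<Longrightarrow> (\<forall>i\<in>S'. cs' ! i = cs ! i) \<Longrightarrow>
      query_answer cs' x j = query_answer cs x j"
    using query_answer_determined by metis
  show ?case
  proof (intro exI[of _ "S' \<union> S"] conjI allI impI)
    show "S' \<union> S \<subseteq> {..<length cs}" using S(1) S'(1) by simp
    show "card (S' \<union> S) \<le> num_queries (query_answer cs) (Query x j f)"
      using card_Un_le[of S' S] S(2) S'(2) by simp
    show "accepts (query_answer cs') (Query x j f) = accepts (query_answer cs) (Query x j f)"
      if "map fst cs' = map fst cs" "\<forall>i\<in>S' \<union> S. cs' ! i = cs ! i" for cs'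
      using S(3)[OF that(1)] S'(3)[OF that(1)] that(2) by simp
  qed
qed

text \<open>The constraints that were not queried keep their variables but receive new signs, so
  that the satisfiable instance answers every query of the run in the same way.\<close>

lemma accepts_if_locally_satisfiable:
  assumes t: "\<And>cs'. csp_instance k n d cs' \<Longrightarrow> satisfiable P cs' \<Longrightarrow> accepts (query_answer cs') t"
    and P: "card {x \<in> cube k. P x} > 0"
    and cs: "csp_instance k n d cs"
    and loc: "\<And>S. S \<subseteq> {..<length cs} \<Longrightarrow> card S \<le> num_queries (query_answer cs) t \<Longrightarrow>
      \<exists>a. \<forall>i\<in>S. sat_constraint P a (cs ! i)"
  shows "accepts (query_answer cs) t"
proof -
  have len: "length (fst (cs ! i)) = k \<and> length (snd (cs ! i)) = k \<and> set (fst (cs ! i)) \<subseteq> {..<n}"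
    if "i < length cs" for i
    using cs nth_mem[OF that] unfolding csp_instance_def by (simp add: case_prod_beta)
  obtain S where S: "S \<subseteq> {..<length cs}" "card S \<le> num_queries (query_answer cs) t"
    "\<And>cs'. map fst cs' = map fst cs \<Longrightarrow> (\<forall>i\<in>S. cs' ! i = cs ! i) \<Longrightarrow>
      accepts (query_answer cs') t = accepts (query_answer cs) t"
    using accepts_determined by metis
  obtain a where a: "\<And>i. i \<in> S \<Longrightarrow> sat_constraint P a (cs ! i)"
    using loc[OF S(1,2)] by blast
  have "{x \<in> cube k. P x} \<noteq> {}" using P by (metis card.empty less_irrefl)
  then obtain x where x: "x \<in> cube k" "P x" by blast
  \<comment> \<open>Outside \<open>S\<close> the signs are chosen so that, under \<open>a\<close>,
    the input to \<open>P\<close> becomes the fixed satisfying \<open>x\<close>.\<close>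
  define c where "c i = (if i \<in> S then cs ! i
    else (fst (cs ! i), map2 (\<lambda>v y. a v \<noteq> y) (fst (cs ! i)) x))" for i
  define cs' where "cs' = map c [0..<length cs]"
  have fsts: "map fst cs' = map fst cs"
    by (rule nth_equalityI) (auto simp: cs'_def c_def)
  have sat: "sat_constraint P a (c i)" if "i < length cs" for i
  proof (cases "i \<in> S")
    case False
    have "map2 (\<lambda>v b. a v \<noteq> b) (fst (cs ! i)) (map2 (\<lambda>v y. a v \<noteq> y) (fst (cs ! i)) x) = x"
      using len[OF that] x(1) by (intro nth_equalityI) (auto simp: cube_def)
    then show ?thesis using False x(2) by (simp only: c_def sat_constraint_def if_False fst_conv snd_conv)
  qed (simp add: c_def a)
  have "satisfiable P cs'"
    unfolding satisfiable_def using sat by (intro exI[of _ a]) (auto simp: cs'_def)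
  moreover have "csp_instance k n d cs'"
  proof -
    have "length (constraints_on cs' y) = length (constraints_on cs y)" for y
      using constraints_on_eq_map_nth[of cs' y] constraints_on_eq_map_nth[of cs y] fsts
        map_eq_imp_length_eq[OF fsts] by simp
    moreover have "length (fst (c i)) = k \<and> length (snd (c i)) = k \<and> set (fst (c i)) \<subseteq> {..<n}"
      if "i < length cs" for i
      using len[OF that] x(1) by (auto simp: c_def cube_def)
    then have "\<forall>(vs, bs)\<in>set cs'. length vs = k \<and> length bs = k \<and> set vs \<subseteq> {..<n}"
      by (auto simp: cs'_def case_prod_beta)
    ultimately show ?thesis using cs by (simp add: csp_instance_def)
  qed
  ultimately have "accepts (query_answer cs') t" by (intro t)
  moreover have "\<forall>i\<in>S. cs' ! i = cs ! i" using S(1) by (auto simp: cs'_def c_def)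
  ultimately show ?thesis using S(3)[OF fsts] by simp
qed

section \<open>Hard instances and the lower bound\<close>

lemma far_from_satI:
  assumes "\<And>a. \<delta> * real d * real n / real k \<le> real (card {p. p < length cs \<and> \<not> sat_constraint P a (cs ! p)})"
  shows "far_from_sat k P n d \<delta> cs"
  unfolding far_from_sat_def
proof (intro allI impI)
  fix R assume R: "R \<subseteq> {..<length cs}" "satisfiable P (nths cs (- R))"
  then obtain a where a: "\<And>c. c \<in> set (nths cs (- R)) \<Longrightarrow> sat_constraint P a c"
    by (auto simp: satisfiable_def)
  have "sat_constraint P a (cs ! p)" if "p < length cs" "p \<notin> R" for p
    using that by (intro a) (auto simp: set_nths)
  then have "{p. p < length cs \<and> \<not> sat_constraint P a (cs ! p)} \<subseteq> R" by blast
  then have "card {p. p < length cs \<and> \<not> sat_constraint P a (cs ! p)} \<le> card R"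
    using R(1) finite_subset by (intro card_mono) auto
  then show "\<delta> * real d * real n / real k \<le> real (card R)"
    using assms[of a] by linarith
qed

lemma exists_hard_instances:
  fixes \<epsilon> :: real
  assumes P: "k \<ge> 3" "card {x \<in> cube k. P x} > 0" "symmetric_pred k P"
    "\<exists>x\<in>cube k. P x \<noteq> EQU x" and \<epsilon>: "\<epsilon> > 0"
  shows "\<exists>d\<ge>1. \<exists>c>0. \<forall>n>0. \<exists>cs. csp_instance k n d cs \<and>
    far_from_sat k P n d (real (card {x \<in> cube k. \<not> P x}) / 2 ^ k - \<epsilon>) cs \<and>
    (\<forall>S\<subseteq>{..<length cs}. real (card S) \<le> c * real n \<longrightarrow> (\<exists>a. \<forall>i\<in>S. sat_constraint P a (cs ! i)))"
proof -
  define \<delta> where "\<delta> = real (card {x \<in> cube k. \<not> P x}) / 2 ^ k - \<epsilon>"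
  \<comment> \<open>With this density, 2 exp(-D0 \<epsilon>^2/2) < 1, so the concentration over
    \<open>D0 * n\<close> constraints beats the 2^n assignments.\<close>
  obtain D0 :: nat where D0: "2 / \<epsilon>\<^sup>2 < real D0" using reals_Archimedean2 by blast
  have D: "0 < D0" using D0 \<epsilon> by (metis of_nat_0 divide_pos_pos not_gr_zero order_less_asym zero_less_numeral zero_less_power)
  have "1 < real D0 * (\<epsilon>\<^sup>2 / 2)" using D0 \<epsilon> by (simp add: field_simps)
  then have "2 < exp (real D0 * (\<epsilon>\<^sup>2 / 2))"
    using exp_ge_add_one_self[of "real D0 * (\<epsilon>\<^sup>2 / 2)"] by linarith
  then have sm: "2 * exp (- (\<epsilon>\<^sup>2 / 2)) ^ D0 < 1"
    by (simp add: exp_minus field_simps flip: exp_of_nat_mult)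
  obtain c where c: "c > 0" "\<And>n. n > 0 \<Longrightarrow> \<exists>\<tau>. \<tau> permutes {..<D0 * n * k} \<and>
    (\<forall>E. E \<subseteq> {..<D0 * n} \<longrightarrow> E \<noteq> {} \<longrightarrow> real (card E) \<le> c * real n \<longrightarrow>
      (2 * k - 3) * card E < 2 * card (\<Union>p\<in>E. set (slot_edge k n \<tau> p)))"
    using exists_expanding_slot_hypergraph[of k D0] P(1) D by auto
  have "\<exists>cs. csp_instance k n (k * D0) cs \<and> far_from_sat k P n (k * D0) \<delta> cs \<and>
    (\<forall>S\<subseteq>{..<length cs}. real (card S) \<le> c * real n \<longrightarrow> (\<exists>a. \<forall>i\<in>S. sat_constraint P a (cs ! i)))"
    if n: "n > 0" for n
  proof -
    obtain \<tau> where \<tau>: "\<tau> permutes {..<D0 * n * k}"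
      "\<And>E. E \<subseteq> {..<D0 * n} \<Longrightarrow> E \<noteq> {} \<Longrightarrow> real (card E) \<le> c * real n \<Longrightarrow>
      (2 * k - 3) * card E < 2 * card (\<Union>p\<in>E. set (slot_edge k n \<tau> p))"
      using c(2)[OF n] by blast
    let ?e = "slot_edge k n \<tau>"
    have e: "length (?e p) = k \<and> set (?e p) \<subseteq> {..<n}" for p
      using n by (auto simp: slot_edge_def)
    have "2 ^ n * exp (- (\<epsilon>\<^sup>2 / 2)) ^ (D0 * n) = (2 * exp (- (\<epsilon>\<^sup>2 / 2)) ^ D0) ^ n"
      by (simp add: power_mult_distrib power_mult)
    also have "\<dots> < 1" using sm n by (intro power_less_one_iff[THEN iffD2]) auto
    finally obtain b where b: "\<And>p. p < D0 * n \<Longrightarrow> length (b p) = k"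
      "\<And>a. \<delta> * real (D0 * n) \<le> real (card {p. p < D0 * n \<and> \<not> sat_constraint P a (?e p, b p)})"
      using exists_signs_violated_by_all[of "D0 * n" ?e k n \<epsilon> P] e \<epsilon> unfolding \<delta>_def by auto
    define cs where "cs = map (\<lambda>p. (?e p, b p)) [0..<D0 * n]"
    have nth: "cs ! p = (?e p, b p)" if "p < D0 * n" for p using that by (simp add: cs_def)
    have len: "length cs = D0 * n" by (simp add: cs_def)
    have "length (constraints_on cs x) \<le> k * D0" if "x < n" for x
    proof -
      have "length (constraints_on cs x) = card {p. p < D0 * n \<and> x \<in> set (?e p)}"
        unfolding constraints_on_def length_filter_conv_card len
        by (rule arg_cong[where f = card]) (auto simp: nth)
      then show ?thesis using slot_edge_degree_le[OF \<tau>(1) that] by simp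
    qed
    then have "csp_instance k n (k * D0) cs"
      using e b(1) by (auto simp: csp_instance_def cs_def)
    moreover have "far_from_sat k P n (k * D0) \<delta> cs"
    proof (rule far_from_satI)
      fix a
      have "{p. p < D0 * n \<and> \<not> sat_constraint P a (?e p, b p)} =
          {p. p < length cs \<and> \<not> sat_constraint P a (cs ! p)}"
        using len nth by auto
      \<comment> \<open>For degree bound \<open>k * D0\<close> the normalization
        \<open>d * n / k\<close> is exactly the number \<open>D0 * n\<close> of constraints.\<close>
      then show "\<delta> * real (k * D0) * real n / real k \<le>
          real (card {p. p < length cs \<and> \<not> sat_constraint P a (cs ! p)})"
        using b(2)[of a] P(1) by (simp add: mult_ac)
    qed
    moreover have "\<exists>a. \<forall>i\<in>S. sat_constraint P a (cs ! i)"
      if S: "S \<subseteq> {..<length cs}" "real (card S) \<le> c * real n" for S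
    proof -
      have "\<exists>a. \<forall>i\<in>S. sat_constraint P a (?e i, b i)"
      proof (rule expanding_satisfiable[OF P])
        show fS: "finite S" using S(1) finite_subset by auto
        show "length (b i) = k" if "i \<in> S" for i using that S(1) b(1) len by auto
        show "(2 * k - 3) * card S' < 2 * card (\<Union>i\<in>S'. set (?e i))" if S': "S' \<subseteq> S" "S' \<noteq> {}" for S'
        proof (rule \<tau>(2)[OF _ S'(2)])
          show "S' \<subseteq> {..<D0 * n}" using S' S(1) len by auto
          have "real (card S') \<le> real (card S)" using card_mono[OF fS S'(1)] by simp
          then show "real (card S') \<le> c * real n" using S(2) by linarith
        qed
      qed (use e in auto)
      then show ?thesis using nth S(1) len by (metis lessThan_iff subsetD)
    qed
    ultimately show ?thesis by blast
  qed
  then show ?thesis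
    using c(1) P(1) D unfolding \<delta>_def by (intro exI[of _ "k * D0"]) (auto simp: Suc_le_eq)
qed

theorem theorem8:
  fixes k :: nat and P :: "bool list \<Rightarrow> bool" and \<epsilon> :: real
  assumes "k \<ge> 3"
    and "card {x \<in> cube k. P x} > 0"
    and "symmetric_pred k P"
    and "\<exists>x\<in>cube k. P x \<noteq> EQU x"
    and "\<epsilon> > 0"
  shows "\<exists>d\<ge>1. \<exists>c>0. \<exists>n0. \<forall>n\<ge>n0. \<forall>T q.
           one_sided_tester k P n d (real (card {x \<in> cube k. \<not> P x}) / 2 ^ k - \<epsilon>) T \<longrightarrow>
           query_complexity_le k n d T q \<longrightarrow>
           real q \<ge> c * real n"
proof -
  define \<delta> where "\<delta> = real (card {x \<in> cube k. \<not> P x}) / 2 ^ k - \<epsilon>"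
  obtain d c where dc: "d \<ge> 1" "c > 0" and hard: "\<forall>n>0. \<exists>cs. csp_instance k n d cs \<and>
    far_from_sat k P n d \<delta> cs \<and>
    (\<forall>S\<subseteq>{..<length cs}. real (card S) \<le> c * real n \<longrightarrow> (\<exists>a. \<forall>i\<in>S. sat_constraint P a (cs ! i)))"
    using exists_hard_instances[OF assms, folded \<delta>_def] by (elim exE conjE) (rule that)
  have "real q \<ge> c * real n"
    if n: "n \<ge> 1" and T: "one_sided_tester k P n d \<delta> T" and q: "query_complexity_le k n d T q" for n T q
  proof (rule ccontr)
    assume "\<not> ?thesis"
    then have lt: "real q < c * real n" by simp
    obtain cs where cs: "csp_instance k n d cs" "far_from_sat k P n d \<delta> cs"
      "\<And>S. S \<subseteq> {..<length cs} \<Longrightarrow> real (card S) \<le> c * real n \<Longrightarrow> \<exists>a. \<forall>i\<in>S. sat_constraint P a (cs ! i)"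
      using hard n by (metis Suc_le_eq One_nat_def)
    \<comment> \<open>Acceptance with probability 1 passes to every decision tree in the support.
      Each such tree makes at most \<open>q < c * n\<close> queries on \<open>cs\<close>, so what it
      sees is satisfiable and it has to accept the far instance.\<close>
    have "accepts (query_answer cs) t" if t: "t \<in> set_pmf T" for t
    proof (rule accepts_if_locally_satisfiable[OF _ assms(2) cs(1)])
      fix cs' assume "csp_instance k n d cs'" "satisfiable P cs'"
      then have "measure_pmf.prob T {t. accepts (query_answer cs') t} = 1"
        using T by (simp add: one_sided_tester_def accept_prob_def)
      then show "accepts (query_answer cs') t"
        using t by (simp add: measure_pmf.prob_eq_1 AE_measure_pmf_iff)
    next
      fix S assume "S \<subseteq> {..<length cs}" and S: "card S \<le> num_queries (query_answer cs) t"
      moreover have "num_queries (query_answer cs) t \<le> q"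
        using q cs(1) t by (simp add: query_complexity_le_def)
      then have "real (card S) \<le> real q" using S by simp
      ultimately show "\<exists>a. \<forall>i\<in>S. sat_constraint P a (cs ! i)"
        using lt by (intro cs(3)) auto
    qed
    then have "reject_prob T cs = 0"
      unfolding reject_prob_def by (intro measure_pmf_zero_iff[THEN iffD2]) auto
    moreover have "reject_prob T cs \<ge> 2 / 3"
      using T cs by (simp add: one_sided_tester_def tester_def)
    ultimately show False by simp
  qed
  then show ?thesis using dc unfolding \<delta>_def by blast
qed

end
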